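(* (i) Let $\Phi(x,y)\in\mathbb{C}[x,y]$ be a homogeneous standard polynomial. Then $G(\Phi)^*$ is a Cayley digraph on the multiplicative group $(\mathbb{C}^*,\cdot)$, i.e. $G(\Phi)^*=\mathrm{Cay}(\mathbb{C}^*,S)$ for some finite nonempty $S\subset\mathbb{C}^*$ with $1\notin S$. (ii) Let $\mathrm{Cay}(\mathbb{C}^*,S)$ be a Cayley digraph on $(\mathbb{C}^*,\cdot)$, where $S\subset\mathbb{C}^*$ is finite and nonempty with $1\notin S$. Then there exists a homogeneous standard polynomial $\Phi(x,y)\in\mathbb{C}[x,y]$ such that $\mathrm{Cay}(\mathbb{C}^*,S)=G(\Phi)^*$.
   Context: $\mathbb{C}^*=\mathbb{C}\setminus\{0\}$. Digraphs may be infinite and may have loops and multiple arcs. The (weakly connected) component of a vertex $u$ is the subdigraph induced by all vertices joined to $u$ by a path when arc directions are ignored. For $\Phi(x,y)\in\mathbb{C}[x,y]$, the digraph $G(\Phi)$ has vertex set $\mathbb{C}$, and $(u,v)$ is an arc of multiplicity $m\ge1$ if $v$ is a root of multiplicity $m$ of $\Phi(u,y)$ (if $\Phi(u,y)$ is the zero polynomial, every $(u,v)$ is an arc of multiplicity $1$). Write $\Phi(x,y)=\sum_{i=0}^d a_i(x)y^i=\sum_{j=0}^e b_j(y)x^j$ with $a_d,b_e\neq 0$, and set $A(x)=\gcd(a_0,\dots,a_d)$, $B(y)=\gcd(b_0,\dots,b_e)$, $D(x)=\mathrm{Resultant}(\Phi,\Phi'_y,y)$, $E(y)=\mathrm{Resultant}(\Phi,\Phi'_x,x)$,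 $L(x)=\Phi(x,x)$, where $\Phi'_x,\Phi'_y$ are the partial derivatives. $\Phi$ is standard if it is non-constant, $A$ and $B$ are constant, and none of $D$, $E$, $L$ is the zero polynomial (non-vanishing of $D$ and $E$ means that $\Phi$ has no repeated non-constant factor). For standard $\Phi$, the singular vertices are the roots of $S(x)=L(x)D(x)E(x)$; equivalently, the vertices $u$ that have a loop, or are the origin or end of a multiple arc, or have $a_d(u)=0$ (outdegree less than $d$) or $b_e(u)=0$ (indegree less than $e$). A singular component is a component containing a singular vertex. $G(\Phi)^*$ is the digraph obtained from $G(\Phi)$ by removing all singular components. For a group $\Gamma$ and a finite nonempty set $S\subseteq\Gamma$ not containing the identity, the Cayley digraph $\mathrm{Cay}(\Gamma,S)$ has vertex set $\Gamma$, and $(u,v)$ is an arc (of multiplicity $1$) if and only if $v=su$ for some $s\in S$. $S$ is not required to generate $\Gamma$. *)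

theory Defs
  imports
    Complex_Main
    "HOL-Algebra.Group"
    "HOL-Computational_Algebra.Polynomial_Factorial"
    "HOL-Computational_Algebra.Field_as_Ring"
    "Subresultants.Resultant_Prelim"
    "Graph_Theory.Digraph_Component"
begin

section \<open>Digraphs given by arc multiplicities\<close>

text \<open>
  The \<open>m u v\<close> parallel arcs from \<open>u\<close> to \<open>v\<close> are named \<open>(u, v, 0), \<dots>, (u, v, m u v - 1)\<close>.
  With this naming, two such digraphs are equal as records if and only if they have the same
  vertices and the same arc multiplicities on them, and induced subgraphs keep the naming.
\<close>

definition mult_digraph :: "'a set \<Rightarrow> ('a \<Rightarrow> 'a \<Rightarrow> nat) \<Rightarrow> ('a, 'a \<times> 'a \<times> nat) pre_digraph" where
  "mult_digraph V m =
     \<lparr> verts = V,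
       arcs = {(u, v, k). u \<in> V \<and> v \<in> V \<and> k < m u v},
       tail = (\<lambda>(u, v, k). u),
       head = (\<lambda>(u, v, k). v) \<rparr>"

definition weak_component :: "('a, 'b) pre_digraph \<Rightarrow> 'a \<Rightarrow> ('a, 'b) pre_digraph" where
  "weak_component G u = G \<restriction> {v \<in> verts G. u \<rightarrow>\<^sup>*\<^bsub>with_proj (mk_symmetric G)\<^esub> v}"

definition Cay :: "('a, 'b) monoid_scheme \<Rightarrow> 'a set \<Rightarrow> ('a, 'a \<times> 'a \<times> nat) pre_digraph" where
  "Cay \<Gamma> S = mult_digraph (carrier \<Gamma>) (\<lambda>u v. if \<exists>s\<in>S. v = s \<otimes>\<^bsub>\<Gamma>\<^esub> u then 1 else 0)"

definition Cstar :: "complex monoid" where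
  "Cstar = \<lparr> carrier = - {0}, mult = (*), one = 1 \<rparr>"

lemma group_Cstar: "group Cstar"
proof (rule groupI)
  fix x assume "x \<in> carrier Cstar"
  then show "\<exists>y\<in>carrier Cstar. y \<otimes>\<^bsub>Cstar\<^esub> x = \<one>\<^bsub>Cstar\<^esub>"
    by (intro bexI[of _ "inverse x"]) (auto simp: Cstar_def)
qed (auto simp: Cstar_def)

section \<open>Bivariate polynomials\<close>

text \<open>
  \<open>\<Phi>(x, y)\<close> is represented as a polynomial in \<open>y\<close> over the polynomials in \<open>x\<close>:
  \<open>coeff \<Phi> i\<close> is \<open>a\<^sub>i(x)\<close>, and \<open>coeff (coeff \<Phi> i) j\<close> is the coefficient of \<open>x\<^sup>j y\<^sup>i\<close>.
  Exchanging the variables gives the expansion in powers of \<open>x\<close>: \<open>coeff (swap_xy \<Phi>) j\<close> is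
  \<open>b\<^sub>j(y)\<close>.
\<close>

definition swap_xy :: "'a::comm_ring_1 poly poly \<Rightarrow> 'a poly poly" where
  "swap_xy \<Phi> = (\<Sum>i\<le>degree \<Phi>. \<Sum>j\<le>degree (coeff \<Phi> i). monom (monom (coeff (coeff \<Phi> i) j) i) j)"

lemma coeff_swap_xy: "coeff (coeff (swap_xy \<Phi>) j) i = coeff (coeff \<Phi> i) j"
proof -
  have inner: "(\<Sum>j'\<le>degree (coeff \<Phi> i'). coeff (coeff (monom (monom (coeff (coeff \<Phi> i') j') i') j') j) i)
      = (if i' = i then coeff (coeff \<Phi> i) j else 0)" for i'
  proof -
    have "(\<Sum>j'\<le>degree (coeff \<Phi> i'). coeff (coeff (monom (monom (coeff (coeff \<Phi> i') j') i') j') j) i)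
      = (\<Sum>j'\<le>degree (coeff \<Phi> i'). if j' = j then (if i' = i then coeff (coeff \<Phi> i) j else 0) else 0)"
      by (intro sum.cong) auto
    also have "\<dots> = (if i' = i then coeff (coeff \<Phi> i) j else 0)"
      by (auto simp: coeff_eq_0)
    finally show ?thesis .
  qed
  have "coeff (coeff (swap_xy \<Phi>) j) i =
      (\<Sum>i'\<le>degree \<Phi>. if i' = i then coeff (coeff \<Phi> i) j else 0)"
    unfolding swap_xy_def by (simp only: coeff_sum inner)
  also have "\<dots> = coeff (coeff \<Phi> i) j"
    by (auto simp: coeff_eq_0)
  finally show ?thesis .
qed

text \<open>The univariate polynomial \<open>\<Phi>(u, y)\<close>.\<close>

definition spec_x :: "complex poly poly \<Rightarrow> complex \<Rightarrow> complex poly" where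
  "spec_x \<Phi> u = map_poly (\<lambda>a. poly a u) \<Phi>"

definition homogeneous :: "complex poly poly \<Rightarrow> bool" where
  "homogeneous \<Phi> \<longleftrightarrow> (\<exists>n. \<forall>i j. coeff (coeff \<Phi> i) j \<noteq> 0 \<longrightarrow> i + j = n)"

text \<open>
  \<open>pderiv\<close> differentiates with respect to the outer variable, so \<open>pderiv \<Phi>\<close> is \<open>\<Phi>'\<^sub>y\<close> and
  \<open>pderiv (swap_xy \<Phi>)\<close> is \<open>\<Phi>'\<^sub>x\<close>. The resultants are determinants of Sylvester matrices whose size
  is given by the actual degrees; \<open>E\<close> and \<open>B\<close> are polynomials in \<open>y\<close>.
\<close>

definition A_poly :: "complex poly poly \<Rightarrow> complex poly" where
  "A_poly \<Phi> = content \<Phi>"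

definition B_poly :: "complex poly poly \<Rightarrow> complex poly" where
  "B_poly \<Phi> = content (swap_xy \<Phi>)"

definition D_poly :: "complex poly poly \<Rightarrow> complex poly" where
  "D_poly \<Phi> = resultant \<Phi> (pderiv \<Phi>)"

definition E_poly :: "complex poly poly \<Rightarrow> complex poly" where
  "E_poly \<Phi> = resultant (swap_xy \<Phi>) (pderiv (swap_xy \<Phi>))"

text \<open>\<open>\<Phi>(x, x)\<close>: the outer variable is replaced by \<open>x\<close>.\<close>

definition L_poly :: "complex poly poly \<Rightarrow> complex poly" where
  "L_poly \<Phi> = poly \<Phi> [:0, 1:]"

definition standard :: "complex poly poly \<Rightarrow> bool" where
  "standard \<Phi> \<longleftrightarrow>
     (\<nexists>c. \<Phi> = [:[:c:]:]) \<and> degree (A_poly \<Phi>) = 0 \<and> degree (B_poly \<Phi>) = 0 \<and>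
     D_poly \<Phi> \<noteq> 0 \<and> E_poly \<Phi> \<noteq> 0 \<and> L_poly \<Phi> \<noteq> 0"

section \<open>The digraph of a polynomial\<close>

definition poly_digraph :: "complex poly poly \<Rightarrow> (complex, complex \<times> complex \<times> nat) pre_digraph" where
  "poly_digraph \<Phi> =
     mult_digraph UNIV (\<lambda>u v. if spec_x \<Phi> u = 0 then 1 else order v (spec_x \<Phi> u))"

definition singular_verts :: "complex poly poly \<Rightarrow> complex set" where
  "singular_verts \<Phi> = {u. poly (L_poly \<Phi> * D_poly \<Phi> * E_poly \<Phi>) u = 0}"

definition singular_components ::
    "complex poly poly \<Rightarrow> (complex, complex \<times> complex \<times> nat) pre_digraph set" where
  "singular_components \<Phi> =
     {C. \<exists>u. C = weak_component (poly_digraph \<Phi>) u \<and> verts C \<inter> singular_verts \<Phi> \<noteq> {}}"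

definition poly_digraph_star ::
    "complex poly poly \<Rightarrow> (complex, complex \<times> complex \<times> nat) pre_digraph" where
  "poly_digraph_star \<Phi> =
     poly_digraph \<Phi> \<restriction> (verts (poly_digraph \<Phi>) - (\<Union>C\<in>singular_components \<Phi>. verts C))"

end

theory Submission
  imports
    Defs
    "HOL-Computational_Algebra.Fundamental_Theorem_Algebra"
    "Subresultants.Subresultant_Gcd"
begin

text \<open>
  Constancy of the contents \<open>A\<close> and \<open>B\<close> forces a homogeneous standard polynomial of degree \<open>n\<close>
  to contain both \<open>x\<^sup>n\<close> and \<open>y\<^sup>n\<close>. Hence it is \<open>\<Phi>(x, y) = x\<^sup>n p(y / x)\<close> for a univariate
  polynomial \<open>p\<close> of degree \<open>n \<ge> 1\<close> with \<open>p(0) \<noteq> 0\<close>. The other conditions on \<open>\<Phi>\<close> translate into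
  conditions on \<open>p\<close>: \<open>L(x) = p(1) x\<^sup>n\<close>, and for \<open>u \<noteq> 0\<close> the polynomial \<open>\<Phi>(u, y)\<close> is \<open>p\<close> up to
  scaling, so that \<open>D(u) \<noteq> 0\<close> exactly when \<open>p\<close> has only simple roots. Exchanging \<open>x\<close> and \<open>y\<close>
  reverses the coefficients of \<open>p\<close>, which inverts its roots and keeps their multiplicities, so
  \<open>E\<close> says the same as \<open>D\<close>. Thus homogeneous standard polynomials correspond to polynomials \<open>p\<close>
  with simple roots, at least one of them, and neither \<open>0\<close> nor \<open>1\<close> among them
  (\<open>standard_homogenization\<close>, \<open>homogeneous_standard_imp_homogenization\<close>); up to a constant
  factor, such a \<open>p\<close> is the same as a finite nonempty set \<open>S\<close> of roots avoiding \<open>0\<close> and \<open>1\<close>.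

  The only singular vertex is then \<open>0\<close>, and it is a component by itself: from \<open>\<Phi>(0, y) = c y\<^sup>n\<close>
  all arcs from \<open>0\<close> are loops, and from \<open>\<Phi>(u, 0) = p(0) u\<^sup>n\<close> no other vertex has an arc to \<open>0\<close>.
  What remains is the digraph on the nonzero numbers in which the arcs from \<open>u\<close> lead to the
  simple roots \<open>s u\<close> of \<open>\<Phi>(u, y)\<close>, where \<open>s \<in> S\<close>: this is the Cayley digraph
  (\<open>poly_digraph_star_homogenization\<close>).
\<close>

section \<open>Homogenization of a univariate polynomial\<close>

text \<open>\<open>x\<^sup>n p(y / x)\<close>, where \<open>n\<close> is the degree of \<open>p\<close>.\<close>

definition homogenization :: "complex poly \<Rightarrow> complex poly poly" where
  "homogenization p = (\<Sum>i\<le>degree p. monom (monom (coeff p i) (degree p - i)) i)"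

lemma coeff_homogenization: "coeff (homogenization p) i = monom (coeff p i) (degree p - i)"
proof -
  have "coeff (homogenization p) i =
      (\<Sum>k\<le>degree p. if k = i then monom (coeff p i) (degree p - i) else 0)"
    unfolding homogenization_def coeff_sum by (intro sum.cong) auto
  then show ?thesis
    by (auto simp: coeff_eq_0)
qed

lemma degree_homogenization: "degree (homogenization p) = degree p"
proof (rule antisym)
  show "degree (homogenization p) \<le> degree p"
    by (intro degree_le) (auto simp: coeff_homogenization coeff_eq_0)
  show "degree p \<le> degree (homogenization p)"
  proof (cases "p = 0")
    case False
    then show ?thesis
      by (intro le_degree) (simp add: coeff_homogenization)
  qed simp
qed

lemma homogeneous_homogenization: "homogeneous (homogenization p)"
  unfolding homogeneous_def
proof (intro exI allI impI)
  fix i j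
  assume nz: "coeff (coeff (homogenization p) i) j \<noteq> 0"
  then have "j = degree p - i" "coeff p i \<noteq> 0"
    by (auto simp: coeff_homogenization split: if_splits)
  then show "i + j = degree p"
    using le_degree[of p i] by simp
qed

lemma coeff_spec_x: "coeff (spec_x \<Phi> u) i = poly (coeff \<Phi> i) u"
  by (simp add: spec_x_def coeff_map_poly)

lemma spec_x_homogenization:
  assumes "u \<noteq> 0"
  shows "spec_x (homogenization p) u = smult (u ^ degree p) (p \<circ>\<^sub>p [:0, inverse u:])"
proof (rule poly_eqI)
  fix i
  show "coeff (spec_x (homogenization p) u) i =
      coeff (smult (u ^ degree p) (p \<circ>\<^sub>p [:0, inverse u:])) i"
  proof (cases "i \<le> degree p")
    case True
    then have "u ^ (degree p - i) = u ^ degree p * inverse u ^ i"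
      using assms by (simp add: power_diff field_simps)
    then show ?thesis
      by (simp add: coeff_spec_x coeff_homogenization poly_monom coeff_pcompose_linear)
  qed (simp add: coeff_spec_x coeff_homogenization coeff_pcompose_linear coeff_eq_0)
qed

lemma spec_x_homogenization_0:
  "spec_x (homogenization p) 0 = monom (lead_coeff p) (degree p)"
proof (rule poly_eqI)
  fix i
  show "coeff (spec_x (homogenization p) 0) i = coeff (monom (lead_coeff p) (degree p)) i"
    using le_degree[of p i]
    by (cases "i < degree p") (auto simp: coeff_spec_x coeff_homogenization poly_monom)
qed

lemma degree_spec_x_homogenization: "degree (spec_x (homogenization p) u) = degree p"
  by (cases "u = 0"; cases "p = 0")
    (simp_all add: spec_x_homogenization spec_x_homogenization_0 degree_monom_eq degree_pcompose)

lemma poly_spec_x_homogenization: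
  "u \<noteq> 0 \<Longrightarrow> poly (spec_x (homogenization p) u) v = u ^ degree p * poly p (v / u)"
  by (simp add: spec_x_homogenization poly_pcompose divide_inverse mult.commute)

text \<open>Multiple roots are common roots with the derivative, and scaling permutes them.\<close>

lemma rsquarefree_spec_x_homogenization:
  assumes "u \<noteq> 0"
  shows "rsquarefree (spec_x (homogenization p) u) \<longleftrightarrow> rsquarefree p"
proof -
  have "rsquarefree (spec_x (homogenization p) u) \<longleftrightarrow>
      (\<forall>v. \<not> (poly p (inverse u * v) = 0 \<and> poly (pderiv p) (inverse u * v) = 0))"
    using assms
    by (simp add: rsquarefree_roots spec_x_homogenization pderiv_smult pderiv_pcompose
        poly_pcompose pderiv_pCons mult.commute)
  also have "\<dots> \<longleftrightarrow> rsquarefree p"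
  proof -
    have "a = inverse u * (u * a)" for a
      using assms by simp
    then show ?thesis
      unfolding rsquarefree_roots by metis
  qed
  finally show ?thesis .
qed

lemma spec_x_pderiv: "spec_x (pderiv \<Phi>) u = pderiv (spec_x \<Phi> u)"
  by (rule poly_eqI) (simp add: coeff_spec_x coeff_pderiv)

section \<open>The discriminants and the diagonal polynomial\<close>

text \<open>
  A vanishing resultant means a nonconstant common factor, and over the complex numbers such a
  factor has a root, which is then a multiple root.
\<close>

lemma resultant_pderiv_eq_0_iff:
  fixes f :: "complex poly"
  assumes "f \<noteq> 0"
  shows "resultant f (pderiv f) = 0 \<longleftrightarrow> \<not> rsquarefree f"
proof
  assume "resultant f (pderiv f) = 0"
  then have "degree (gcd f (pderiv f)) \<noteq> 0"
    by (simp add: resultant_0_gcd)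
  then obtain a where "poly (gcd f (pderiv f)) a = 0"
    using fundamental_theorem_of_algebra[of "gcd f (pderiv f)"] constant_degree by metis
  then have "poly f a = 0" "poly (pderiv f) a = 0"
    by (meson gcd_dvd1 gcd_dvd2 poly_eq_0_iff_dvd dvd_trans)+
  then show "\<not> rsquarefree f"
    by (auto simp: rsquarefree_roots)
next
  assume "\<not> rsquarefree f"
  then obtain a where "poly f a = 0" "poly (pderiv f) a = 0"
    by (auto simp: rsquarefree_roots)
  then have "[:-a, 1:] dvd gcd f (pderiv f)"
    by (simp add: poly_eq_0_iff_dvd)
  then have "degree [:-a, 1:] \<le> degree (gcd f (pderiv f))"
    using assms by (intro dvd_imp_degree_le) auto
  then show "resultant f (pderiv f) = 0"
    by (simp add: resultant_0_gcd)
qed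

text \<open>
  Resultants commute with evaluation only where the degrees do not drop. Here they never do,
  because the leading coefficient in \<open>y\<close> is a constant.
\<close>

lemma poly_D_poly_homogenization:
  "poly (D_poly (homogenization p)) u =
    resultant (spec_x (homogenization p) u) (pderiv (spec_x (homogenization p) u))"
proof -
  have eval: "comm_ring_hom (\<lambda>a. poly a u)"
    by unfold_locales auto
  have "degree (map_poly (\<lambda>a. poly a u) (pderiv (homogenization p))) =
      degree (pderiv (homogenization p))"
    using spec_x_pderiv[of "homogenization p" u]
    by (simp add: spec_x_def[symmetric] degree_pderiv degree_homogenization
        degree_spec_x_homogenization)
  then show ?thesis
    using comm_ring_hom.resultant_map_poly[OF eval, of "homogenization p" "pderiv (homogenization p)"]
    by (simp add: D_poly_def spec_x_def[symmetric] spec_x_pderiv degree_homogenization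
        degree_spec_x_homogenization)
qed

lemma poly_D_poly_homogenization_eq_0_iff:
  assumes "p \<noteq> 0" "u \<noteq> 0"
  shows "poly (D_poly (homogenization p)) u = 0 \<longleftrightarrow> \<not> rsquarefree p"
proof -
  have "poly (spec_x (homogenization p) u) (u * a) = u ^ degree p * poly p a" for a
    using assms by (simp add: poly_spec_x_homogenization)
  moreover obtain a where "poly p a \<noteq> 0"
    using assms(1) poly_all_0_iff_0 by blast
  ultimately have "spec_x (homogenization p) u \<noteq> 0"
    using assms(2) by (metis mult_eq_0_iff poly_0 power_not_zero)
  then show ?thesis
    using assms(2)
    by (simp add: poly_D_poly_homogenization resultant_pderiv_eq_0_iff
        rsquarefree_spec_x_homogenization)
qed

text \<open>
  Whether \<open>D(u) = 0\<close> is the same question at all nonzero \<open>u\<close>, so \<open>D\<close> vanishes everywhere if it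
  vanishes at one of them.
\<close>

lemma D_poly_homogenization_eq_0_iff:
  assumes "p \<noteq> 0"
  shows "D_poly (homogenization p) = 0 \<longleftrightarrow> \<not> rsquarefree p"
proof
  assume "D_poly (homogenization p) = 0"
  then show "\<not> rsquarefree p"
    using poly_D_poly_homogenization_eq_0_iff[OF assms, of 1] by simp
next
  assume "\<not> rsquarefree p"
  then have "- {0} \<subseteq> {u. poly (D_poly (homogenization p)) u = 0}"
    using assms by (auto simp: poly_D_poly_homogenization_eq_0_iff)
  moreover have "infinite (- {0 :: complex})"
    by (simp add: infinite_UNIV_char_0)
  ultimately show "D_poly (homogenization p) = 0"
    using poly_roots_finite finite_subset by blast
qed

text \<open>
  If \<open>p(0)\<close> were \<open>0\<close>, the reversed polynomial and hence its homogenization would have a degree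
  smaller than that of \<open>p\<close>.
\<close>

lemma swap_xy_homogenization:
  assumes "coeff p 0 \<noteq> 0"
  shows "swap_xy (homogenization p) = homogenization (reflect_poly p)"
proof (intro poly_eqI)
  fix i j
  show "coeff (coeff (swap_xy (homogenization p)) j) i =
      coeff (coeff (homogenization (reflect_poly p)) j) i"
    using assms
    by (auto simp: coeff_swap_xy coeff_homogenization coeff_reflect_poly coeff_eq_0)
qed

lemma E_poly_homogenization:
  "coeff p 0 \<noteq> 0 \<Longrightarrow> E_poly (homogenization p) = D_poly (homogenization (reflect_poly p))"
  by (simp add: E_poly_def D_poly_def swap_xy_homogenization)

text \<open>
  Reversal is multiplicative and, up to a constant factor, turns \<open>X - a\<close> into \<open>X - 1/a\<close>. A
  multiple root \<open>a\<close> of the reversed polynomial would thus be a multiple root \<open>1/a\<close> of \<open>p\<close>.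
\<close>

lemma rsquarefree_reflect_poly:
  fixes p :: "'a :: field_char_0 poly"
  assumes "rsquarefree p" "coeff p 0 \<noteq> 0"
  shows "rsquarefree (reflect_poly p)"
proof (rule ccontr)
  let ?q = "reflect_poly p"
  have q0: "?q \<noteq> 0" "poly ?q 0 \<noteq> 0"
    using assms(2) by auto
  assume "\<not> rsquarefree ?q"
  then obtain a where "order a ?q \<noteq> 0" "order a ?q \<noteq> 1"
    using q0 by (auto simp: rsquarefree_def)
  then have "2 \<le> order a ?q" and "poly ?q a = 0"
    using q0 by (auto simp: order_root)
  then have "[:-a, 1:] ^ 2 dvd ?q"
    using order_1[of a ?q] le_imp_power_dvd dvd_trans by blast
  then obtain r where "?q = [:-a, 1:] ^ 2 * r" ..
  then have "reflect_poly ?q = reflect_poly [:-a, 1:] ^ 2 * reflect_poly r"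
    by (simp only: reflect_poly_mult reflect_poly_power)
  moreover have "a \<noteq> 0"
    using \<open>poly ?q a = 0\<close> q0(2) by auto
  then have "reflect_poly [:-a, 1:] = [:1, -a:]"
    by (simp add: reflect_poly_def)
  moreover have "[:1, -a:] = smult (-a) [:- inverse a, 1:]"
    using \<open>a \<noteq> 0\<close> by simp
  ultimately have "p = smult (-a) [:- inverse a, 1:] ^ 2 * reflect_poly r"
    using reflect_poly_reflect_poly[OF assms(2)] by metis
  also have "\<dots> = smult (a ^ 2) ([:- inverse a, 1:] ^ 2 * reflect_poly r)"
    by (simp only: smult_power mult_smult_left power2_minus)
  finally have "p = smult (a ^ 2) ([:- inverse a, 1:] ^ 2 * reflect_poly r)" .
  then have "[:- inverse a, 1:] ^ 2 dvd p"
    by (metis dvd_smult dvd_triv_left)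
  moreover have "p \<noteq> 0"
    using assms(2) by auto
  ultimately have "2 \<le> order (inverse a) p"
    using order_divides[of "inverse a" 2 p] by metis
  moreover have "order (inverse a) p = 0 \<or> order (inverse a) p = 1"
    using assms(1) by (simp add: rsquarefree_def)
  ultimately show False
    by linarith
qed

lemma poly_L_poly: "poly (L_poly \<Phi>) u = poly (spec_x \<Phi> u) u"
  by (induction \<Phi>) (auto simp: L_poly_def spec_x_def map_poly_pCons)

text \<open>
  The scaling formula does not cover \<open>u = 0\<close>; there \<open>L(0)\<close> is \<open>0\<close>, or the constant \<open>p(1)\<close> if \<open>p\<close>
  has degree \<open>0\<close>, which the power \<open>0\<^sup>0 = 1\<close> accounts for.
\<close>

lemma poly_L_poly_homogenization: "poly (L_poly (homogenization p)) u = u ^ degree p * poly p 1"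
proof (cases "u = 0")
  case True
  then show ?thesis
    by (cases "degree p = 0")
       (auto simp: poly_L_poly spec_x_homogenization_0 poly_monom elim!: degree_eq_zeroE)
qed (simp add: poly_L_poly poly_spec_x_homogenization)

lemma L_poly_homogenization_eq_0_iff: "L_poly (homogenization p) = 0 \<longleftrightarrow> poly p 1 = 0"
proof
  assume "L_poly (homogenization p) = 0"
  then show "poly p 1 = 0"
    using poly_L_poly_homogenization[of p 1] by simp
next
  assume "poly p 1 = 0"
  then show "L_poly (homogenization p) = 0"
    using poly_all_0_iff_0[of "L_poly (homogenization p)"]
    by (simp add: poly_L_poly_homogenization)
qed

section \<open>Homogeneous standard polynomials are homogenizations\<close>

lemma degree_content_eq_0:
  fixes \<Phi> :: "complex poly poly"
  assumes "degree (coeff \<Phi> i) = 0" "coeff \<Phi> i \<noteq> 0"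
  shows "degree (content \<Phi>) = 0"
  using dvd_imp_degree_le[OF content_dvd_coeff[of \<Phi> i] assms(2)] assms(1) by simp

text \<open>
  If the coefficient of \<open>y\<^sup>n\<close> were zero, every other monomial of degree \<open>n\<close> being divisible by
  \<open>x\<close>, the content would be divisible by \<open>x\<close> too.
\<close>

lemma coeff_ne_0_if_content_constant:
  fixes \<Phi> :: "complex poly poly"
  assumes hom: "\<And>i j. coeff (coeff \<Phi> i) j \<noteq> 0 \<Longrightarrow> i + j = n"
    and "\<Phi> \<noteq> 0" "degree (content \<Phi>) = 0"
  shows "coeff (coeff \<Phi> n) 0 \<noteq> 0"
proof
  assume z: "coeff (coeff \<Phi> n) 0 = 0"
  have "coeff (coeff \<Phi> i) 0 = 0" for i
    using hom[of i 0] z by (cases "i = n") auto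
  then have "[:0, 1:] dvd coeff \<Phi> i" for i
    using poly_eq_0_iff_dvd[of "coeff \<Phi> i" 0] by (simp add: poly_0_coeff_0)
  then have "[:0, 1:] dvd content \<Phi>"
    by (metis const_poly_dvd_iff const_poly_dvd_iff_dvd_content)
  moreover have "content \<Phi> \<noteq> 0"
    using assms(2) by simp
  ultimately have "degree [:0, 1 :: complex:] \<le> degree (content \<Phi>)"
    by (rule dvd_imp_degree_le)
  then show False
    using assms(3) by simp
qed

text \<open>These are the \<open>p\<close> for which \<open>x\<^sup>n p(y / x)\<close> is standard.\<close>

definition admissible :: "complex poly \<Rightarrow> bool" where
  "admissible p \<longleftrightarrow> degree p > 0 \<and> poly p 0 \<noteq> 0 \<and> poly p 1 \<noteq> 0 \<and> rsquarefree p"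

lemma standard_homogenization:
  assumes "admissible p"
  shows "standard (homogenization p)"
proof -
  have p: "degree p > 0" "coeff p 0 \<noteq> 0" "poly p 1 \<noteq> 0" "rsquarefree p" "p \<noteq> 0"
    using assms by (auto simp: admissible_def poly_0_coeff_0)
  have "\<nexists>c. homogenization p = [:[:c:]:]"
    using p(1) degree_homogenization[of p] by (metis degree_pCons_0 less_irrefl)
  moreover have "degree (A_poly (homogenization p)) = 0"
    unfolding A_poly_def using p
    by (intro degree_content_eq_0[where i = "degree p"])
       (simp_all add: coeff_homogenization monom_0)
  moreover have "degree (B_poly (homogenization p)) = 0"
    unfolding B_poly_def swap_xy_homogenization[OF p(2)] using p
    by (intro degree_content_eq_0[where i = "degree p"])
       (simp_all add: coeff_homogenization monom_0 coeff_reflect_poly)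
  moreover have "D_poly (homogenization p) \<noteq> 0" "E_poly (homogenization p) \<noteq> 0"
    using p rsquarefree_reflect_poly[of p]
    by (simp_all add: D_poly_homogenization_eq_0_iff E_poly_homogenization)
  moreover have "L_poly (homogenization p) \<noteq> 0"
    using p by (simp add: L_poly_homogenization_eq_0_iff)
  ultimately show ?thesis
    unfolding standard_def by blast
qed

text \<open>The polynomial \<open>p\<close> is recovered from \<open>\<Phi>\<close> as \<open>\<Phi>(1, y)\<close>.\<close>

lemma homogeneous_standard_imp_homogenization:
  assumes "homogeneous \<Phi>" "standard \<Phi>"
  obtains p where "admissible p" "\<Phi> = homogenization p"
proof -
  obtain n where hom: "\<And>i j. coeff (coeff \<Phi> i) j \<noteq> 0 \<Longrightarrow> i + j = n"
    using assms(1) unfolding homogeneous_def by metis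
  define p where "p = spec_x \<Phi> 1"
  have "\<Phi> \<noteq> 0"
    using assms(2) unfolding standard_def by (metis pCons_0_0)
  then have "swap_xy \<Phi> \<noteq> 0"
    by (metis coeff_0 coeff_swap_xy poly_eqI)
  have top: "coeff (coeff \<Phi> n) 0 \<noteq> 0"
    using coeff_ne_0_if_content_constant[of \<Phi> n] hom \<open>\<Phi> \<noteq> 0\<close> assms(2)
    by (auto simp: standard_def A_poly_def)
  have bottom: "coeff (coeff \<Phi> 0) n \<noteq> 0"
  proof -
    have "i + j = n" if "coeff (coeff (swap_xy \<Phi>) i) j \<noteq> 0" for i j
      using hom[of j i] that by (simp add: coeff_swap_xy)
    moreover have "degree (content (swap_xy \<Phi>)) = 0"
      using assms(2) by (simp add: standard_def B_poly_def)
    ultimately show ?thesis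
      using coeff_ne_0_if_content_constant[of "swap_xy \<Phi>" n] \<open>swap_xy \<Phi> \<noteq> 0\<close>
      by (simp add: coeff_swap_xy)
  qed
  have monoms: "coeff \<Phi> i = monom (coeff p i) (n - i)" for i
  proof -
    have "coeff \<Phi> i = monom (coeff (coeff \<Phi> i) (n - i)) (n - i)"
      using hom[of i] by (intro poly_eqI) fastforce
    moreover from arg_cong[OF this, of "\<lambda>a. poly a 1"]
    have "coeff p i = coeff (coeff \<Phi> i) (n - i)"
      by (simp add: p_def coeff_spec_x poly_monom)
    ultimately show ?thesis by simp
  qed
  have "degree p = n"
  proof (rule antisym)
    have "coeff \<Phi> i = 0" if "n < i" for i
      using hom[of i] that by (intro poly_eqI) fastforce
    then show "degree p \<le> n"
      by (intro degree_le) (auto simp: p_def coeff_spec_x)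
    show "n \<le> degree p"
      using top monoms[of n] by (intro le_degree) auto
  qed
  then have \<Phi>: "\<Phi> = homogenization p"
    by (intro poly_eqI) (simp add: monoms coeff_homogenization)
  have "coeff p 0 \<noteq> 0"
    using bottom monoms[of 0] by auto
  moreover have "n \<noteq> 0"
  proof
    assume "n = 0"
    then have "\<Phi> = [:[:coeff p 0:]:]"
      using \<Phi> \<open>degree p = n\<close> by (simp add: homogenization_def monom_0)
    then show False
      using assms(2) unfolding standard_def by blast
  qed
  moreover have "p \<noteq> 0"
    using \<open>coeff p 0 \<noteq> 0\<close> by auto
  then have "rsquarefree p"
    using assms(2) D_poly_homogenization_eq_0_iff[of p] by (simp add: standard_def \<Phi>)
  moreover have "poly p 1 \<noteq> 0"
    using assms(2) by (auto simp: standard_def \<Phi> L_poly_homogenization_eq_0_iff)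
  ultimately have "admissible p"
    using \<open>degree p = n\<close> by (simp add: admissible_def poly_0_coeff_0)
  then show thesis
    using \<Phi> that by blast
qed

section \<open>Removing the singular component\<close>

lemma singular_verts_homogenization:
  assumes "admissible p"
  shows "singular_verts (homogenization p) = {0}"
proof -
  have p: "degree p > 0" "coeff p 0 \<noteq> 0" "poly p 1 \<noteq> 0" "rsquarefree p" "p \<noteq> 0"
    using assms by (auto simp: admissible_def poly_0_coeff_0)
  have "poly (L_poly (homogenization p)) 0 = 0"
    using p by (simp add: poly_L_poly_homogenization)
  moreover have "poly (L_poly (homogenization p) * D_poly (homogenization p) *
      E_poly (homogenization p)) u \<noteq> 0" if "u \<noteq> 0" for u
    using p that rsquarefree_reflect_poly[of p]
    by (simp add: poly_L_poly_homogenization poly_D_poly_homogenization_eq_0_iff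
        E_poly_homogenization)
  ultimately show ?thesis
    by (auto simp: singular_verts_def)
qed

text \<open>
  The first hypothesis says that all arcs at \<open>w\<close> are loops, in a form that survives reversing
  arcs; being equal to \<open>w\<close> is therefore invariant along undirected paths.
\<close>

lemma reachable_isolated_vertex_iff:
  assumes "\<And>e. e \<in> arcs G \<Longrightarrow> tail G e = w \<longleftrightarrow> head G e = w"
    and "u \<rightarrow>\<^sup>*\<^bsub>with_proj (mk_symmetric G)\<^esub> v"
  shows "u = w \<longleftrightarrow> v = w"
  using assms(2) unfolding reachable_def
proof (induction rule: rtrancl_on.induct)
  case (rtrancl_on_into_rtrancl_on a b c)
  then show ?case
    using assms(1) by (auto simp: parcs_mk_symmetric)
qed simp

lemma singular_components_isolated:
  assumes "singular_verts \<Phi> = {w}"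
    and "\<And>e. e \<in> arcs (poly_digraph \<Phi>) \<Longrightarrow>
      tail (poly_digraph \<Phi>) e = w \<longleftrightarrow> head (poly_digraph \<Phi>) e = w"
  shows "(\<Union>C\<in>singular_components \<Phi>. verts C) = {w}"
proof -
  let ?G = "poly_digraph \<Phi>"
  have verts: "verts ?G = UNIV"
    by (simp add: poly_digraph_def mult_digraph_def)
  have comp: "verts (weak_component ?G u) =
      {v. u \<rightarrow>\<^sup>*\<^bsub>with_proj (mk_symmetric ?G)\<^esub> v}" for u
    by (simp add: weak_component_def verts)
  have refl: "w \<rightarrow>\<^sup>*\<^bsub>with_proj (mk_symmetric ?G)\<^esub> w"
    by (simp add: reachable_def verts)
  have iso: "u = w \<longleftrightarrow> v = w" if "u \<rightarrow>\<^sup>*\<^bsub>with_proj (mk_symmetric ?G)\<^esub> v" for u v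
    using reachable_isolated_vertex_iff[OF assms(2) that] .
  have w: "verts (weak_component ?G w) = {w}"
    using refl iso by (auto simp: comp)
  have "u = w" if "w \<in> verts (weak_component ?G u)" for u
    using that iso by (auto simp: comp)
  then have "singular_components \<Phi> = {weak_component ?G w}"
    unfolding singular_components_def assms(1) using w by auto
  then show ?thesis
    by (simp add: w)
qed

section \<open>The correspondence with Cayley digraphs\<close>

text \<open>
  For \<open>u \<noteq> 0\<close> the roots of \<open>\<Phi>(u, y)\<close> are simple, so all multiplicities are at most \<open>1\<close>; and
  \<open>v\<close> is such a root exactly when \<open>v / u\<close> is a root of \<open>p\<close>.
\<close>

lemma poly_digraph_star_homogenization:
  assumes "admissible p"
  shows "poly_digraph_star (homogenization p) = Cay Cstar {s. poly p s = 0}"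
proof -
  let ?\<Phi> = "homogenization p"
  have p: "degree p > 0" "poly p 0 \<noteq> 0" "rsquarefree p" "p \<noteq> 0"
    using assms by (auto simp: admissible_def)
  define m where "m = (\<lambda>u v. if spec_x ?\<Phi> u = 0 then 1 else order v (spec_x ?\<Phi> u))"
  have G: "poly_digraph ?\<Phi> = mult_digraph UNIV m"
    by (simp add: poly_digraph_def m_def)
  have nz: "spec_x ?\<Phi> u \<noteq> 0" for u
    using p(1) degree_spec_x_homogenization[of p u] by auto
  have m: "m u v = (if poly (spec_x ?\<Phi> u) v = 0 then 1 else 0)" if "u \<noteq> 0" for u v
    using that p nz[of u] rsquarefree_root_order[of "spec_x ?\<Phi> u" v]
    by (simp add: m_def rsquarefree_spec_x_homogenization order_0I)
  have "m 0 v = 0" if "v \<noteq> 0" for v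
    using that p(4) by (simp add: m_def nz order_0I spec_x_homogenization_0 poly_monom)
  moreover have "m u 0 = 0" if "u \<noteq> 0" for u
    using that p(2) by (simp add: m poly_spec_x_homogenization)
  ultimately have loops: "tail (poly_digraph ?\<Phi>) e = 0 \<longleftrightarrow> head (poly_digraph ?\<Phi>) e = 0"
    if "e \<in> arcs (poly_digraph ?\<Phi>)" for e
    using that by (auto simp: G mult_digraph_def) (metis less_nat_zero_code)+
  have "(\<Union>C\<in>singular_components ?\<Phi>. verts C) = {0}"
    using singular_verts_homogenization[OF assms] loops by (rule singular_components_isolated)
  then have "poly_digraph_star ?\<Phi> = mult_digraph UNIV m \<restriction> (- {0})"
    unfolding poly_digraph_star_def
    by (simp only:) (simp add: G mult_digraph_def Compl_eq_Diff_UNIV)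
  also have "\<dots> = Cay Cstar {s. poly p s = 0}"
  proof -
    have "m u v = (if \<exists>s\<in>{s. poly p s = 0}. v = s \<otimes>\<^bsub>Cstar\<^esub> u then 1 else 0)" if "u \<noteq> 0" for u v
    proof -
      have "(\<exists>s\<in>{s. poly p s = 0}. v = s \<otimes>\<^bsub>Cstar\<^esub> u) \<longleftrightarrow> poly p (v / u) = 0"
        using that by (auto simp: Cstar_def intro!: exI[of _ "v / u"])
      then show ?thesis
        using that by (simp add: m poly_spec_x_homogenization)
    qed
    then show ?thesis
      by (auto simp: Cay_def mult_digraph_def induce_subgraph_def Cstar_def)
  qed
  finally show ?thesis .
qed

lemma admissible_prod_linear:
  assumes "finite S" "S \<noteq> {}" "0 \<notin> S" "1 \<notin> S"
  shows "admissible (\<Prod>s\<in>S. [:-s, 1:])" (is "admissible ?p")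
    and "{s. poly (\<Prod>s\<in>S. [:-s, 1:]) s = 0} = S"
proof -
  have roots: "poly ?p s = 0 \<longleftrightarrow> s \<in> S" for s
    using assms(1) by (auto simp: poly_prod prod_zero_iff)
  then show "{s. poly ?p s = 0} = S"
    by simp
  have "degree ?p = card S"
    by (subst degree_prod_sum_eq) auto
  moreover have "rsquarefree ?p"
  proof -
    have "proots ?p = (\<Sum>s\<in>S. {#s#})"
      by (subst proots_prod) (simp_all only: proots_linear_factor minus_minus pCons_eq_0_iff
        one_neq_zero simp_thms not_False_eq_True)
    also have "\<dots> = mset_set S"
      by (simp add: sum_multiset_singleton)
    finally have roots_mset: "proots ?p = mset_set S" .
    have "?p \<noteq> 0"
      using assms(1) by simp
    moreover from this have "order a ?p = count (mset_set S) a" for a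
      by (metis roots_mset count_proots)
    ultimately show ?thesis
      using assms(1) by (auto simp: rsquarefree_def count_mset_set')
  qed
  ultimately show "admissible ?p"
    using assms roots by (auto simp: admissible_def card_gt_0_iff)
qed

theorem theorem5:
  shows "(\<forall>\<Phi>. homogeneous \<Phi> \<and> standard \<Phi> \<longrightarrow>
            (\<exists>S. finite S \<and> S \<noteq> {} \<and> S \<subseteq> carrier Cstar \<and> \<one>\<^bsub>Cstar\<^esub> \<notin> S \<and>
                 poly_digraph_star \<Phi> = Cay Cstar S)) \<and>
         (\<forall>S. finite S \<and> S \<noteq> {} \<and> S \<subseteq> carrier Cstar \<and> \<one>\<^bsub>Cstar\<^esub> \<notin> S \<longrightarrow>
            (\<exists>\<Phi>. homogeneous \<Phi> \<and> standard \<Phi> \<and> Cay Cstar S = poly_digraph_star \<Phi>))"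
proof (intro conjI allI impI; elim conjE)
  fix \<Phi>
  assume "homogeneous \<Phi>" "standard \<Phi>"
  then obtain p where p: "admissible p" and \<Phi>: "\<Phi> = homogenization p"
    by (rule homogeneous_standard_imp_homogenization)
  let ?S = "{s. poly p s = 0}"
  have "finite ?S"
    using p by (intro poly_roots_finite) (auto simp: admissible_def)
  moreover have "?S \<noteq> {}"
    using p fundamental_theorem_of_algebra[of p] constant_degree[of p]
    by (auto simp: admissible_def)
  moreover have "?S \<subseteq> carrier Cstar" "\<one>\<^bsub>Cstar\<^esub> \<notin> ?S"
    using p by (auto simp: admissible_def Cstar_def)
  moreover have "poly_digraph_star \<Phi> = Cay Cstar ?S"
    using poly_digraph_star_homogenization[OF p] by (simp add: \<Phi>)
  ultimately show "\<exists>S. finite S \<and> S \<noteq> {} \<and> S \<subseteq> carrier Cstar \<and> \<one>\<^bsub>Cstar\<^esub> \<notin> S \<and>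
      poly_digraph_star \<Phi> = Cay Cstar S"
    by blast
next
  fix S
  assume S: "finite S" "S \<noteq> {}" "S \<subseteq> carrier Cstar" "\<one>\<^bsub>Cstar\<^esub> \<notin> S"
  let ?p = "\<Prod>s\<in>S. [:-s, 1:]"
  have "admissible ?p" "{s. poly ?p s = 0} = S"
    using S admissible_prod_linear[of S] by (auto simp: Cstar_def)
  then show "\<exists>\<Phi>. homogeneous \<Phi> \<and> standard \<Phi> \<and> Cay Cstar S = poly_digraph_star \<Phi>"
    using homogeneous_homogenization standard_homogenization poly_digraph_star_homogenization
    by metis
qed

end
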